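(* When the noisy labels have equal prior, i.e. $\mathbb P(\widetilde Y=0)=\mathbb P(\widetilde Y=1)$, the peer loss is a special form of negative label smoothing regularization with the smooth rate $r_{\mathrm{PL}}:=2\cdot\mathbb P(\widetilde Y=1)$. Besides, $$\min_{f\in\mathcal F}\mathbb{E}_{(X,\widetilde Y)\sim\widetilde{\mathcal D}}\big[\ell_{\mathrm{PL}}(\mathbf f(X),\widetilde Y)\big]=\min_{f\in\mathcal F}\mathbb{E}_{(X,\widetilde Y)\sim\widetilde{\mathcal D}}\big[\ell(\mathbf f(X),\widetilde Y^{\mathrm{GLS},r\to-\infty})\big].$$
   Context: Binary classification: $(X,\widetilde Y)\sim\widetilde{\mathcal D}$ with $X\in\mathcal X$ and noisy label $\widetilde Y\in\{0,1\}$. A model $f$ assigns to each $x$ a probability vector $\mathbf f(x)=(\mathbf f(x)_0,\mathbf f(x)_1)$ (a softmax output); $\mathcal F$ is the hypothesis space of models under consideration. The loss is cross-entropy, $\ell(\mathbf f(x),y)=-\log \mathbf f(x)_y$, extended linearly to vector labels: $\ell(\mathbf f(x),\mathbf v)=-\sum_{k} v_k\log\mathbf f(x)_k$ for $\mathbf v\in\mathbb R^2$. Generalized label smoothing: for a label $y$ with one-hot vector $\mathbf y\in\mathbb R^2$ and smooth rate $r\in(-\infty,1]$, $\mathbf y^{\mathrm{GLS},r}=(1-r)\mathbf y+\frac r2\mathbf 1$ with $\mathbf 1$ the all-ones vector; $\widetilde Y^{\mathrm{GLS},r}$ is the smoothed version of $\widetilde Y$. The smooth rate $r\to-\infty$ is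 understood after normalizing the smoothed label by $1-r$, which gives $\mathbf y^{\mathrm{GLS},r\to-\infty}=\mathbf y-\frac12\mathbf 1$. Peer loss: $\ell_{\mathrm{PL}}(\mathbf f(X),\widetilde Y):=\ell(\mathbf f(X),\widetilde Y)-\ell(\mathbf f(X_1),\widetilde Y_2)$, where $(X_1,\widetilde Y_1)$ and $(X_2,\widetilde Y_2)$ are two randomly (independently) selected samples from $\widetilde{\mathcal D}$, so that the second term is evaluated on a randomly paired feature and label; the expectation of $\ell_{\mathrm{PL}}$ is over all these draws. "Negative label smoothing regularization with smooth rate $r_{\mathrm{PL}}$" refers to the risk minimization $\min_{f\in\mathcal F}\mathbb{E}_{(X,\widetilde Y)\sim\widetilde{\mathcal D}}\big[\ell(\mathbf f(X),\widetilde Y)-\ell(\mathbf f(X),\widetilde Y^{\mathrm{GLS},r_{\mathrm{PL}}})\big]$, in which the smoothed-label loss enters with negative weight as a regularizer; the first assertion is that $\min_{f\in\mathcal F}\mathbb{E}[\ell_{\mathrm{PL}}(\mathbf f(X),\widetilde Y)]$ equals this minimization. *)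

theory Defs
  imports "HOL-Probability.Probability" "HOL-Real_Asymp.Real_Asymp"
begin

text \<open>
  Labels are the elements \<open>0\<close> and \<open>1\<close> of the two-element type \<open>2\<close>, which also indexes the
  components of vectors in \<open>real^2\<close>, so that \<open>f x $ y\<close> is the component of the prediction at the
  label \<open>y\<close>. In this type the numeral \<open>2\<close> denotes \<open>0\<close>.
\<close>

text \<open>
  A softmax output has strictly positive components, so \<open>ln\<close> below is never taken at \<open>0\<close> (where
  its value in HOL is \<open>0\<close>).
\<close>
definition is_model :: "'x measure \<Rightarrow> ('x \<Rightarrow> real^2) \<Rightarrow> bool" where
  "is_model MX f \<longleftrightarrow> f \<in> MX \<rightarrow>\<^sub>M borel \<and>
     (\<forall>x\<in>space MX. (\<forall>k. f x $ k > 0) \<and> (\<Sum>k\<in>UNIV. f x $ k) = 1)"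

definition cross_entropy :: "real^2 \<Rightarrow> 2 \<Rightarrow> real" where
  "cross_entropy p y = - ln (p $ y)"

definition cross_entropy_vec :: "real^2 \<Rightarrow> real^2 \<Rightarrow> real" where
  "cross_entropy_vec p v = - (\<Sum>k\<in>UNIV. v $ k * ln (p $ k))"

lemma cross_entropy_vec_one_hot: "cross_entropy_vec p (axis y 1) = cross_entropy p y"
proof -
  have "(\<Sum>k\<in>UNIV. axis y 1 $ k * ln (p $ k)) = (\<Sum>k\<in>UNIV. if k = y then ln (p $ k) else 0)"
    by (intro sum.cong) (auto simp: axis_def)
  then show ?thesis
    by (simp add: cross_entropy_vec_def cross_entropy_def)
qed

text \<open>Here \<open>axis y 1\<close> is the one-hot vector of \<open>y\<close> and \<open>1\<close> is the all-ones vector.\<close>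
definition gls :: "real \<Rightarrow> 2 \<Rightarrow> real^2" where
  "gls r y = (1 - r) *\<^sub>R axis y 1 + (r / 2) *\<^sub>R 1"

text \<open>The smooth rate tending to \<open>-\<infinity>\<close>, after normalization of the smoothed label by \<open>1 - r\<close>.\<close>
definition gls_neg_inf :: "2 \<Rightarrow> real^2" where
  "gls_neg_inf y = Lim at_bot (\<lambda>r. gls r y /\<^sub>R (1 - r))"

lemma tendsto_gls_neg_inf:
  "((\<lambda>r. gls r y /\<^sub>R (1 - r)) \<longlongrightarrow> axis y 1 - (1/2) *\<^sub>R 1) at_bot"
proof -
  have "((\<lambda>r::real. (r / 2) / (1 - r)) \<longlongrightarrow> - (1/2)) at_bot"
    by real_asymp
  then have "((\<lambda>r::real. axis y 1 + ((r / 2) / (1 - r)) *\<^sub>R (1 :: real^2)) \<longlongrightarrow>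
      axis y 1 + (- (1/2)) *\<^sub>R 1) at_bot"
    by (intro tendsto_intros)
  moreover have "\<forall>\<^sub>F r::real in at_bot.
      axis y 1 + ((r / 2) / (1 - r)) *\<^sub>R (1 :: real^2) = gls r y /\<^sub>R (1 - r)"
    using eventually_gt_at_bot[of "1::real"]
  proof eventually_elim
    case (elim r)
    then have "inverse (1 - r) * (1 - r) = 1" by simp
    moreover have "gls r y /\<^sub>R (1 - r) =
        (inverse (1 - r) * (1 - r)) *\<^sub>R axis y 1 + (inverse (1 - r) * (r / 2)) *\<^sub>R (1 :: real^2)"
      by (simp only: gls_def scaleR_add_right scaleR_scaleR)
    moreover have "inverse (1 - r) * (r / 2) = (r / 2) / (1 - r)"
      by (simp only: divide_inverse mult.commute)
    ultimately show ?case by (simp only: scaleR_one)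
  qed
  ultimately have "((\<lambda>r. gls r y /\<^sub>R (1 - r)) \<longlongrightarrow> axis y 1 + (- (1/2)) *\<^sub>R 1) at_bot"
    by (rule Lim_transform_eventually)
  then show ?thesis
    by (simp only: scaleR_minus_left diff_conv_add_uminus)
qed

lemma gls_neg_inf_eq: "gls_neg_inf y = axis y 1 - (1/2) *\<^sub>R 1"
  unfolding gls_neg_inf_def
  by (rule tendsto_Lim[OF _ tendsto_gls_neg_inf]) simp

definition noisy_prior :: "('x \<times> 2) measure \<Rightarrow> 2 \<Rightarrow> real" where
  "noisy_prior D y = measure D {z \<in> space D. snd z = y}"

text \<open>
  The peer loss is a function of three draws: the sample \<open>(x, y)\<close> and the two peer samples
  \<open>(x1, y1)\<close> and \<open>(x2, y2)\<close>. They are independent, i.e. distributed according to the threefold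
  product of \<open>D\<close>.
\<close>
definition peer_loss ::
  "('x \<Rightarrow> real^2) \<Rightarrow> ('x \<times> 2) \<times> ('x \<times> 2) \<times> ('x \<times> 2) \<Rightarrow> real" where
  "peer_loss f = (\<lambda>((x, y), (x1, y1), (x2, y2)). cross_entropy (f x) y - cross_entropy (f x1) y2)"

definition peer_measure ::
  "('x \<times> 2) measure \<Rightarrow> (('x \<times> 2) \<times> ('x \<times> 2) \<times> ('x \<times> 2)) measure" where
  "peer_measure D = D \<Otimes>\<^sub>M (D \<Otimes>\<^sub>M D)"

definition peer_risk :: "('x \<times> 2) measure \<Rightarrow> ('x \<Rightarrow> real^2) \<Rightarrow> real" where
  "peer_risk D f = (LINT w|peer_measure D. peer_loss f w)"

definition nls_loss :: "real \<Rightarrow> ('x \<Rightarrow> real^2) \<Rightarrow> 'x \<times> 2 \<Rightarrow> real" where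
  "nls_loss r f = (\<lambda>(x, y). cross_entropy (f x) y - cross_entropy_vec (f x) (gls r y))"

definition nls_risk :: "real \<Rightarrow> ('x \<times> 2) measure \<Rightarrow> ('x \<Rightarrow> real^2) \<Rightarrow> real" where
  "nls_risk r D f = (LINT z|D. nls_loss r f z)"

definition gls_neg_inf_loss :: "('x \<Rightarrow> real^2) \<Rightarrow> 'x \<times> 2 \<Rightarrow> real" where
  "gls_neg_inf_loss f = (\<lambda>(x, y). cross_entropy_vec (f x) (gls_neg_inf y))"

definition gls_neg_inf_risk :: "('x \<times> 2) measure \<Rightarrow> ('x \<Rightarrow> real^2) \<Rightarrow> real" where
  "gls_neg_inf_risk D f = (LINT z|D. gls_neg_inf_loss f z)"

text \<open>
  A minimization \<open>min f\<in>F. R f\<close> is represented by its optimal value, taken in \<open>ereal\<close> because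
  these risks need not be bounded below nor attain their infimum, and by its set of minimizers.
  When a minimizer exists, the optimal value is the risk of any minimizer.
\<close>
definition opt_value :: "('x \<Rightarrow> real^2) set \<Rightarrow> (('x \<Rightarrow> real^2) \<Rightarrow> real) \<Rightarrow> ereal" where
  "opt_value F R = (INF f\<in>F. ereal (R f))"

definition minimizers ::
  "('x \<Rightarrow> real^2) set \<Rightarrow> (('x \<Rightarrow> real^2) \<Rightarrow> real) \<Rightarrow> ('x \<Rightarrow> real^2) set" where
  "minimizers F R = {f. is_arg_min R (\<lambda>f. f \<in> F) f}"

end

theory Submission
  imports Defs
begin

text \<open>
  By Fubini, an integrable difference of functions of two independent variables splits into
  integrable parts. Hence the peer risk is the cross-entropy risk minus the risk against a label
  drawn independently from the noisy prior. Under an equal prior the latter is the risk against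
  the constant label \<open>(1/2, 1/2)\<close>, which is the smoothed label at rate \<open>1\<close>; as
  \<open>axis y 1 - gls 1 y\<close> is exactly \<open>gls_neg_inf y\<close>, all three risks agree on every model.
\<close>

text \<open>Almost every section of an integrable function is integrable, and a probability space
  has a point at which this happens. The section there is \<open>b\<close> (or \<open>a\<close>) up
  to sign and an additive constant, and constants are integrable, so each part inherits
  integrability.\<close>

lemma
  fixes a :: "'a \<Rightarrow> real" and b :: "'b \<Rightarrow> real"
  assumes "prob_space M" "prob_space N"
    and int: "integrable (M \<Otimes>\<^sub>M N) (\<lambda>(x, y). a x - b y)"
  shows integrable_pair_diffD1: "integrable M a"
    and integrable_pair_diffD2: "integrable N b"
    and integral_pair_diff:
      "(\<integral>(x, y). a x - b y \<partial>(M \<Otimes>\<^sub>M N)) = (\<integral>x. a x \<partial>M) - (\<integral>y. b y \<partial>N)"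
proof -
  interpret M: prob_space M by fact
  interpret N: prob_space N by fact
  interpret pair_sigma_finite M N ..
  have "AE x in M. integrable N (\<lambda>y. a x - b y)"
    using AE_integrable_fst'[OF int] by simp
  then obtain x where "integrable N (\<lambda>y. a x - b y)"
    using M.ae_filter_bot eventually_happens by blast
  then have "integrable N (\<lambda>y. a x - (a x - b y))"
    by (rule Bochner_Integration.integrable_diff[OF N.integrable_const])
  then show b: "integrable N b" by simp
  have "AE y in N. integrable M (\<lambda>x. a x - b y)"
    using AE_integrable_snd[of "\<lambda>x y. a x - b y"] int by simp
  then obtain y where "integrable M (\<lambda>x. a x - b y)"
    using N.ae_filter_bot eventually_happens by blast
  then have "integrable M (\<lambda>x. (a x - b y) + b y)"
    by (rule Bochner_Integration.integrable_add[OF _ M.integrable_const])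
  then show a: "integrable M a" by simp
  have "(\<integral>(x, y). a x - b y \<partial>(M \<Otimes>\<^sub>M N)) = (\<integral>x. (\<integral>y. a x - b y \<partial>N) \<partial>M)"
    using integral_fst'[OF int] by simp
  also have "\<dots> = (\<integral>x. a x \<partial>M) - (\<integral>y. b y \<partial>N)"
    using a b by (simp add: M.prob_space N.prob_space)
  finally show "(\<integral>(x, y). a x - b y \<partial>(M \<Otimes>\<^sub>M N)) = (\<integral>x. a x \<partial>M) - (\<integral>y. b y \<partial>N)" .
qed

context prob_space
begin

lemma expectation_finite_valued:
  fixes h :: "'y::finite \<Rightarrow> real"
  assumes [measurable]: "X \<in> M \<rightarrow>\<^sub>M count_space UNIV"
  shows "expectation (\<lambda>z. h (X z)) = (\<Sum>k\<in>UNIV. prob {z \<in> space M. X z = k} * h k)"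
proof -
  have [measurable]: "{z \<in> space M. X z = k} \<in> sets M" for k
    by measurable
  have "expectation (\<lambda>z. h (X z)) =
      expectation (\<lambda>z. \<Sum>k\<in>UNIV. h k * indicator {z \<in> space M. X z = k} z)"
    by (intro Bochner_Integration.integral_cong)
      (auto simp: indicator_def if_distrib cong: if_cong)
  also have "\<dots> = (\<Sum>k\<in>UNIV. prob {z \<in> space M. X z = k} * h k)"
    by (subst Bochner_Integration.integral_sum) (auto simp: emeasure_eq_measure mult.commute)
  finally show ?thesis .
qed

text \<open>All points \<open>z'\<close> with label \<open>k\<close> share the section
  \<open>c z k\<close>. Were it not integrable, the sections would fail to be integrable on a set of
  positive probability, against Fubini.\<close>

lemma integrable_indep_labelD:
  fixes c :: "'a \<Rightarrow> 'y \<Rightarrow> real"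
  assumes [measurable]: "X \<in> M \<rightarrow>\<^sub>M count_space UNIV"
    and int: "integrable (M \<Otimes>\<^sub>M M) (\<lambda>(z, z'). c z (X z'))"
    and pos: "prob {z \<in> space M. X z = k} \<noteq> 0"
  shows "integrable M (\<lambda>z. c z k)"
proof (rule ccontr)
  interpret pair_sigma_finite M M ..
  assume not_int: "\<not> integrable M (\<lambda>z. c z k)"
  have "AE z' in M. integrable M (\<lambda>z. c z (X z'))"
    using AE_integrable_snd[of "\<lambda>z z'. c z (X z')"] int by simp
  then have "AE z' in M. z' \<notin> {z \<in> space M. X z = k}"
    by eventually_elim (use not_int in auto)
  moreover have "{z \<in> space M. X z = k} \<in> events"
    by measurable
  ultimately show False
    using pos prob_eq_0 by blast
qed

lemma integral_indep_label:
  fixes c :: "'a \<Rightarrow> 'y::finite \<Rightarrow> real"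
  assumes "X \<in> M \<rightarrow>\<^sub>M count_space UNIV"
    and int: "integrable (M \<Otimes>\<^sub>M M) (\<lambda>(z, z'). c z (X z'))"
  shows "(\<integral>(z, z'). c z (X z') \<partial>(M \<Otimes>\<^sub>M M)) =
    (\<Sum>k\<in>UNIV. prob {z \<in> space M. X z = k} * expectation (\<lambda>z. c z k))"
proof -
  interpret pair_sigma_finite M M ..
  have "(\<integral>(z, z'). c z (X z') \<partial>(M \<Otimes>\<^sub>M M)) = expectation (\<lambda>z'. expectation (\<lambda>z. c z (X z')))"
    using integral_snd[of "\<lambda>z z'. c z (X z')"] int by simp
  also have "\<dots> = (\<Sum>k\<in>UNIV. prob {z \<in> space M. X z = k} * expectation (\<lambda>z. c z k))"
    \<comment> \<open>The inner expectation depends on \<open>z'\<close> only through its label. At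
      a label of probability 0 it may be the default value 0 of a non-integrable function, with
      weight 0.\<close>
    using assms(1) by (rule expectation_finite_valued)
  finally show ?thesis .
qed

end

lemma UNIV_label: "(UNIV :: 2 set) = {0, 1}"
proof -
  have "(2 :: 2) = 0" by simp
  then show ?thesis using UNIV_2 by auto
qed

text \<open>The vector loss is linear in the label, so writing the hard label as one-hot merges the
  two terms into one loss.\<close>

lemma nls_loss_1_eq: "nls_loss 1 f = gls_neg_inf_loss f"
  by (auto simp: fun_eq_iff nls_loss_def gls_neg_inf_loss_def gls_neg_inf_eq gls_def
      cross_entropy_vec_def UNIV_label algebra_simps simp flip: cross_entropy_vec_one_hot)

text \<open>Subtracting half the all-ones vector from the label subtracts the average loss over both
  labels, which is the form in which the peer term arises.\<close>

lemma gls_neg_inf_loss_eq: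
  "gls_neg_inf_loss f z = cross_entropy (f (fst z)) (snd z)
     - (cross_entropy (f (fst z)) 0 + cross_entropy (f (fst z)) 1) / 2"
proof -
  have "snd z = 0 \<or> snd z = 1"
    using UNIV_label by blast
  then show ?thesis
    by (cases z) (auto simp: gls_neg_inf_loss_def gls_neg_inf_eq cross_entropy_vec_def
        cross_entropy_def axis_def UNIV_label field_simps)
qed

lemma noisy_prior_equal:
  assumes "prob_space D" and X: "snd \<in> D \<rightarrow>\<^sub>M count_space UNIV"
    and eq: "noisy_prior D 0 = noisy_prior D 1"
  shows "noisy_prior D y = 1 / 2"
proof -
  interpret prob_space D by fact
  have "(\<Sum>k\<in>UNIV. noisy_prior D k) = 1"
    \<comment> \<open>The expectation of the constant 1 is the total mass of the label
      distribution.\<close>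
    using expectation_finite_valued[OF X, of "\<lambda>_. 1"] prob_space by (simp add: noisy_prior_def)
  then have "noisy_prior D 0 = 1 / 2" "noisy_prior D 1 = 1 / 2"
    using eq by (simp_all add: UNIV_label)
  moreover have "y = 0 \<or> y = 1"
    using UNIV_label by blast
  ultimately show ?thesis by auto
qed

text \<open>The equal prior enters twice: both labels have positive probability, so the loss against
  each fixed label is integrable, and both weights are 1/2, so the peer term is their
  average.\<close>

lemma
  assumes D: "prob_space D" and X: "snd \<in> D \<rightarrow>\<^sub>M count_space UNIV"
    and int: "integrable (peer_measure D) (peer_loss f)"
    and eq: "noisy_prior D 0 = noisy_prior D 1"
  shows integrable_gls_neg_inf_loss: "integrable D (gls_neg_inf_loss f)"
    and peer_risk_eq_gls_neg_inf_risk: "peer_risk D f = gls_neg_inf_risk D f"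
proof -
  interpret prob_space D by fact
  define a where "a z = cross_entropy (f (fst z)) (snd z)" for z
  define c where "c z y = cross_entropy (f (fst z)) y" for z :: "'a \<times> 2" and y
  \<comment> \<open>The first peer sample supplies the feature, the second one the label.\<close>
  define b where "b = (\<lambda>(z, z' :: 'a \<times> 2). c z (snd z'))"
  have peer: "peer_loss f = (\<lambda>(z, w). a z - b w)"
    by (auto simp: peer_loss_def a_def b_def c_def fun_eq_iff)
  have DD: "prob_space (D \<Otimes>\<^sub>M D)"
    using D D by (rule prob_space_pair)
  note int' = int[unfolded peer peer_measure_def]
  have a: "integrable D a" and b: "integrable (D \<Otimes>\<^sub>M D) b"
    by (rule integrable_pair_diffD1[OF D DD int'] integrable_pair_diffD2[OF D DD int'])+
  have prior: "prob {z \<in> space D. snd z = k} = 1 / 2" for k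
    using noisy_prior_equal[OF D X eq] by (simp add: noisy_prior_def)
  have c: "integrable D (\<lambda>z. c z k)" for k
    using X b[unfolded b_def] by (rule integrable_indep_labelD) (simp add: prior)
  have loss: "gls_neg_inf_loss f = (\<lambda>z. a z - (c z 0 + c z 1) / 2)"
    by (simp add: fun_eq_iff gls_neg_inf_loss_eq a_def c_def)
  show "integrable D (gls_neg_inf_loss f)"
    unfolding loss using a c by simp
  have "peer_risk D f = expectation a - (\<integral>w. b w \<partial>(D \<Otimes>\<^sub>M D))"
    unfolding peer_risk_def peer peer_measure_def by (rule integral_pair_diff[OF D DD int'])
  also have "(\<integral>w. b w \<partial>(D \<Otimes>\<^sub>M D)) = (\<Sum>k\<in>UNIV. 1 / 2 * expectation (\<lambda>z. c z k))"
    using integral_indep_label[OF X b[unfolded b_def]] by (simp add: b_def prior)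
  also have "expectation a - \<dots> = gls_neg_inf_risk D f"
    \<comment> \<open>Integrability of each piece is what lets the integral of \<open>loss\<close>
      split.\<close>
    unfolding gls_neg_inf_risk_def loss using a c by (simp add: UNIV_label field_simps)
  finally show "peer_risk D f = gls_neg_inf_risk D f" .
qed

lemma opt_value_cong: "(\<And>f. f \<in> F \<Longrightarrow> R f = S f) \<Longrightarrow> opt_value F R = opt_value F S"
  by (simp add: opt_value_def)

lemma minimizers_cong: "(\<And>f. f \<in> F \<Longrightarrow> R f = S f) \<Longrightarrow> minimizers F R = minimizers F S"
  by (auto simp: minimizers_def is_arg_min_def)

theorem theorem5p5:
  fixes MX :: "'x measure"
    and D :: "('x \<times> 2) measure"
    and F :: "('x \<Rightarrow> real^2) set"
  assumes "prob_space D"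
    and "sets D = sets (MX \<Otimes>\<^sub>M count_space UNIV)"
    and "\<forall>f\<in>F. is_model MX f"
    and "\<forall>f\<in>F. integrable (peer_measure D) (peer_loss f)"
    and "noisy_prior D 0 = noisy_prior D 1"
  shows "(\<forall>f\<in>F. integrable D (nls_loss (2 * noisy_prior D 1) f) \<and>
                integrable D (gls_neg_inf_loss f)) \<and>
         (opt_value F (peer_risk D) = opt_value F (nls_risk (2 * noisy_prior D 1) D) \<and>
          minimizers F (peer_risk D) = minimizers F (nls_risk (2 * noisy_prior D 1) D)) \<and>
         (opt_value F (peer_risk D) = opt_value F (gls_neg_inf_risk D) \<and>
          minimizers F (peer_risk D) = minimizers F (gls_neg_inf_risk D))"
proof -
  have X: "snd \<in> D \<rightarrow>\<^sub>M count_space UNIV"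
    using measurable_snd measurable_cong_sets[OF assms(2) refl] by blast
  have rate: "2 * noisy_prior D 1 = 1"
    by (simp add: noisy_prior_equal[OF assms(1) X assms(5)])
  \<comment> \<open>The two losses are the same function, so the risks agree for every
    \<open>f\<close>, integrable or not.\<close>
  have nls: "nls_risk 1 D = gls_neg_inf_risk D"
    by (simp add: fun_eq_iff nls_risk_def gls_neg_inf_risk_def nls_loss_1_eq)
  have int: "\<forall>f\<in>F. integrable D (gls_neg_inf_loss f)"
    using integrable_gls_neg_inf_loss[OF assms(1) X _ assms(5)] assms(4) by blast
  have risk: "peer_risk D f = gls_neg_inf_risk D f" if "f \<in> F" for f
    using peer_risk_eq_gls_neg_inf_risk[OF assms(1) X _ assms(5)] assms(4) that by blast
  show ?thesis
    \<comment> \<open>With the rate rewritten to 1, the claims about the two regularized risks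
      become the same claim.\<close>
    unfolding rate nls nls_loss_1_eq
    using int opt_value_cong[of F "peer_risk D", OF risk] minimizers_cong[of F "peer_risk D", OF risk]
    by simp
qed

end
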